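(* Let $X \in \mathcal{B}^{N,M}$ be a Boolean matrix and let $R = \mathrm{rk}_{\mathcal{B}}(X)$ be its Boolean rank. Then $\mathrm{frk}_{\mathcal{B}}(X) = R$ if and only if every rank $R$ Boolean factorization of $X$ is permutation equivalent to one fixed pair of the form $$\begin{pmatrix} I \\ W' \end{pmatrix}, \qquad \begin{pmatrix} I & H' \end{pmatrix},$$ that is, if and only if there exist fixed matrices $W' \in \mathcal{B}^{N-R,R}$, $H' \in \mathcal{B}^{R,M-R}$ and fixed permutation matrices $P$ (of size $N \times N$) and $Q$ (of size $M\times M$) such that for all $W \in \mathcal{B}^{N,R}$, $H \in \mathcal{B}^{R,M}$ with $X = W \land H$ there is an $R \times R$ permutation matrix $U$ with $$P W U = \begin{pmatrix} I \\ W' \end{pmatrix}, \qquad U^{-1} H Q = \begin{pmatrix} I & H' \end{pmatrix},$$ where $I$ is the $R \times R$ identity matrix. In particular, in this case the rank $R$ Boolean factorization of $X$ is unique: if $X = W_1 \land H_1 = W_2 \land H_2$ with $W_1, W_2 \in \mathcal{B}^{N,R}$ and $H_1,H_2 \in \mathcal{B}^{R,M}$, then $W_2 = W_1 \land U$ and $H_2 = U^{-1} \land H_1$ for some invertible $U \in \mathcal{B}^{R,R}$.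
   Context: $\mathcal{B} = \{0,1\}$ is the Boolean semiring with addition $\lor$ (logical or) and multiplication $\land$ (logical and). $W \land H$ denotes the Boolean matrix product, $(W\land H)_{i,j} = \bigvee_k (W_{i,k} \land H_{k,j})$; products with permutation matrices are Boolean matrix products. A matrix $U \in \mathcal{B}^{R,R}$ is invertible if there is $U^{-1} \in \mathcal{B}^{R,R}$ with $U \land U^{-1} = U^{-1} \land U = I$. The Boolean rank is $\mathrm{rk}_{\mathcal{B}}(X) = \min\{R : X = W \land H,\ W \in \mathcal{B}^{N,R},\ H \in \mathcal{B}^{R,M}\}$ (equal to $0$ for the zero matrix). For $X \in \mathcal{B}^{N,M}$, $\mathrm{cone}(X) = \{X \land h : h \in \mathcal{B}^M\} \subset \mathcal{B}^N$. A finite indexed collection $\{v_i\}_{i \in J} \subset \mathcal{B}^N$ is free if for any two subsets $I_1, I_2 \subset J$ with $I_1 \ne I_2$ one has $\bigvee_{i\in I_1} v_i \ne \bigvee_{i \in I_2} v_i$, where the empty join is the zero vector; equivalently, each element of the cone generated by the $v_i$ can be expressed as a Boolean linear combination of the $v_i$ in at most one way. The free (Boolean) rank $\mathrm{frk}_{\mathcal{B}}(X)$ is the size of the largest free subset of $\mathrm{cone}(X)$. *)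

theory Defs
  imports "Jordan_Normal_Form.Matrix" "HOL-Combinatorics.Permutations"
begin

text \<open>With this instance, the library operations on matrices and vectors over \<^typ>\<open>bool\<close>
  (product, sum, identity, zero) are the Boolean ones.\<close>

instantiation bool :: comm_semiring_1
begin

definition zero_bool :: bool where "zero_bool = False"
definition one_bool :: bool where "one_bool = True"
definition plus_bool :: "bool \<Rightarrow> bool \<Rightarrow> bool" where "plus_bool a b = (a \<or> b)"
definition times_bool :: "bool \<Rightarrow> bool \<Rightarrow> bool" where "times_bool a b = (a \<and> b)"

instance
  by standard (auto simp: zero_bool_def one_bool_def plus_bool_def times_bool_def)

end

lemma sum_bool_iff: "finite A \<Longrightarrow> sum f A = (\<exists>x\<in>A. f x)" for f :: "'a \<Rightarrow> bool"
  by (induction A rule: finite_induct) (auto simp: zero_bool_def plus_bool_def)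

lemma index_mult_mat_bool:
  fixes A B :: "bool mat"
  assumes "A \<in> carrier_mat n r" "B \<in> carrier_mat r m" "i < n" "j < m"
  shows "(A * B) $$ (i, j) = (\<exists>k<r. A $$ (i, k) \<and> B $$ (k, j))"
  using assms by (auto simp: scalar_prod_def sum_bool_iff times_bool_def)

text \<open>The case \<open>r = 0\<close> is included: the product of an \<open>n \<times> 0\<close> and a \<open>0 \<times> m\<close> matrix is the
  zero matrix.\<close>

definition boolean_rank :: "bool mat \<Rightarrow> nat" where
  "boolean_rank X = (LEAST r. \<exists>W H. W \<in> carrier_mat (dim_row X) r \<and>
      H \<in> carrier_mat r (dim_col X) \<and> X = W * H)"

definition boolean_cone :: "bool mat \<Rightarrow> bool vec set" where
  "boolean_cone X = {X *\<^sub>v h | h. h \<in> carrier_vec (dim_col X)}"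

definition free_family :: "nat \<Rightarrow> 'i set \<Rightarrow> ('i \<Rightarrow> bool vec) \<Rightarrow> bool" where
  "free_family n J v \<longleftrightarrow> finite J \<and> v \<in> J \<rightarrow> carrier_vec n \<and>
     (\<forall>I\<^sub>1 I\<^sub>2. I\<^sub>1 \<subseteq> J \<longrightarrow> I\<^sub>2 \<subseteq> J \<longrightarrow> I\<^sub>1 \<noteq> I\<^sub>2 \<longrightarrow>
        finsum_vec TYPE(bool) n v I\<^sub>1 \<noteq> finsum_vec TYPE(bool) n v I\<^sub>2)"

text \<open>A subset of the cone is regarded as a family indexed by itself. No generality is lost,
  since a free family is injective (compare singletons).\<close>

definition free_rank :: "bool mat \<Rightarrow> nat" where
  "free_rank X = Max {card S | S. S \<subseteq> boolean_cone X \<and> free_family (dim_row X) S (\<lambda>v. v)}"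

definition permutation_mat :: "nat \<Rightarrow> bool mat \<Rightarrow> bool" where
  "permutation_mat n P \<longleftrightarrow>
     (\<exists>p. p permutes {0..<n} \<and> P = mat n n (\<lambda>(i, j). if j = p i then 1 else 0))"

text \<open>The counterpart of \<^const>\<open>append_rows\<close> for placing matrices side by side.\<close>

definition append_cols :: "bool mat \<Rightarrow> bool mat \<Rightarrow> bool mat" (infixr \<open>@\<^sub>c\<close> 65) where
  "A @\<^sub>c B = four_block_mat A B (0\<^sub>m 0 (dim_col A)) (0\<^sub>m 0 (dim_col B))"

text \<open>The minimum and maximum above are taken over nonempty (and, for the maximum, finite) sets.\<close>

lemma boolean_rank_attained:
  "\<exists>W H. W \<in> carrier_mat (dim_row X) (boolean_rank X) \<and>
     H \<in> carrier_mat (boolean_rank X) (dim_col X) \<and> X = W * H"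
  unfolding boolean_rank_def
proof (rule LeastI_ex)
  have "X = X * 1\<^sub>m (dim_col X)"
    by simp
  then show "\<exists>r W H. W \<in> carrier_mat (dim_row X) r \<and> H \<in> carrier_mat r (dim_col X) \<and> X = W * H"
    by (metis carrier_matI one_carrier_mat)
qed

lemma finite_cone: "finite (boolean_cone X)"
proof -
  have "boolean_cone X \<subseteq> vec_of_list ` {xs. set xs \<subseteq> UNIV \<and> length xs = dim_row X}"
  proof
    fix v assume "v \<in> boolean_cone X"
    then show "v \<in> vec_of_list ` {xs. set xs \<subseteq> UNIV \<and> length xs = dim_row X}"
      by (intro image_eqI[of _ _ "list_of_vec v"]) (auto simp: boolean_cone_def vec_list)
  qed
  moreover have "finite {xs :: bool list. set xs \<subseteq> UNIV \<and> length xs = dim_row X}"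
    by (rule finite_lists_length_eq) simp
  ultimately show ?thesis
    by (metis finite_imageI finite_subset)
qed

lemma free_rank_set:
  defines "C \<equiv> \<lambda>X. {card S | S. S \<subseteq> boolean_cone X \<and> free_family (dim_row X) S (\<lambda>v. v)}"
  shows "finite (C X)" "C X \<noteq> {}"
proof -
  have "C X \<subseteq> card ` Pow (boolean_cone X)"
    by (auto simp: C_def)
  then show "finite (C X)"
    by (rule finite_subset) (simp add: finite_cone)
  have "0 \<in> C X"
    unfolding C_def free_family_def by (intro CollectI exI[of _ "{}"]) auto
  then show "C X \<noteq> {}"
    by blast
qed

end

theory Submission
  imports Defs
begin

text \<open>Both sides of the equivalence say that \<open>X\<close> has an \<open>R \<times> R\<close> permutation submatrix. A free
  family in the cone of \<open>X\<close> gives one: no member lies below the join of the others, so it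
  has a coordinate of its own, and that coordinate comes from a single column of \<open>X\<close>. If \<open>X = W * H\<close>,
  the rows of \<open>W\<close> and columns of \<open>H\<close> that meet this submatrix multiply to the identity, so they are
  mutually inverse permutation matrices, and multiplying \<open>W\<close> and \<open>H\<close> by them yields columns
  and rows of \<open>X\<close>, which do not depend on the factorization.\<close>

unbundle no m_inv_syntax

section \<open>Identity submatrices and the lower bound they put on the inner dimension of a
  product\<close>

lemma index_mult_mat_vec_bool:
  assumes "X \<in> carrier_mat n m" "h \<in> carrier_vec m" "i < n"
  shows "(X *\<^sub>v h :: bool vec) $ i \<longleftrightarrow> (\<exists>k<m. X $$ (i, k) \<and> h $ k)"
  using assms by (auto simp: scalar_prod_def sum_bool_iff times_bool_def)

declare one_bool_def [simp] zero_bool_def [simp]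
  index_mult_mat(1) [simp del] index_mult_mat_vec [simp del]

lemma bool_indicator [simp]: "(if b then 1 else 0 :: bool) = b"
  by simp

text \<open>Rows and columns are listed by maps rather than given as sets: the two listings can
  absorb the permutation, so a permutation submatrix always appears here as the identity.\<close>

definition identity_at :: "bool mat \<Rightarrow> nat \<Rightarrow> (nat \<Rightarrow> nat) \<Rightarrow> (nat \<Rightarrow> nat) \<Rightarrow> bool" where
  "identity_at X n r c \<longleftrightarrow> (\<forall>i<n. r i < dim_row X \<and> c i < dim_col X) \<and>
     (\<forall>i<n. \<forall>j<n. X $$ (r i, c j) \<longleftrightarrow> i = j)"

lemma identity_at_inj:
  assumes "identity_at X n r c"
  shows "inj_on r {..<n}" "inj_on c {..<n}"
proof -
  have "X $$ (r i, c j) \<longleftrightarrow> i = j" if "i < n" "j < n" for i j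
    using assms that by (simp add: identity_at_def)
  then show "inj_on r {..<n}" "inj_on c {..<n}"
    by (intro inj_onI; metis lessThan_iff)+
qed

text \<open>A fooling-set argument. Every diagonal one is covered by some inner index, and an inner
  index covering two of them would also produce an off-diagonal one. So the covering indices are
  distinct.\<close>

lemma identity_at_mult_le:
  assumes id: "identity_at (W * H) n r c"
    and W: "W \<in> carrier_mat N k" and H: "H \<in> carrier_mat k M"
  shows "n \<le> k"
proof -
  have prod: "(\<exists>l<k. W $$ (r i, l) \<and> H $$ (l, c j)) \<longleftrightarrow> i = j" if "i < n" "j < n" for i j
    using id that W H by (simp add: identity_at_def flip: index_mult_mat_bool[OF W H])
  then have "\<forall>i<n. \<exists>l<k. W $$ (r i, l) \<and> H $$ (l, c i)"
    by blast
  then obtain f where f: "\<And>i. i < n \<Longrightarrow> f i < k \<and> W $$ (r i, f i) \<and> H $$ (f i, c i)"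
    by metis
  have "inj_on f {..<n}"
    using f prod by (intro inj_onI) (metis lessThan_iff)
  moreover have "f ` {..<n} \<subseteq> {..<k}"
    using f by auto
  ultimately show ?thesis
    using card_inj_on_le[of f "{..<n}" "{..<k}"] by simp
qed

section \<open>Permutation matrices, and extending an injection to a permutation\<close>

text \<open>The diagonal ones of \<open>A * B\<close> pass through distinct inner indices
  \<open>f i\<close>, so these exhaust all indices below \<open>n\<close>. Any further one in
  \<open>A\<close> or \<open>B\<close> would meet one of the known ones and give an off-diagonal one
  in the product. Hence \<open>A\<close> and \<open>B\<close> are the permutation matrices of
  \<open>f\<close> and its inverse.\<close>

lemma mult_one_imp_permutation:
  fixes A B :: "bool mat"
  assumes A: "A \<in> carrier_mat n n" and B: "B \<in> carrier_mat n n" and AB: "A * B = 1\<^sub>m n"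
  shows "permutation_mat n B" "B * A = 1\<^sub>m n"
proof -
  have prod: "(\<exists>l<n. A $$ (i, l) \<and> B $$ (l, j)) \<longleftrightarrow> i = j" if "i < n" "j < n" for i j
    using that index_mult_mat_bool[OF A B that] by (simp add: AB)
  then have "\<forall>i<n. \<exists>l<n. A $$ (i, l) \<and> B $$ (l, i)"
    by blast
  then obtain f where f: "\<And>i. i < n \<Longrightarrow> f i < n \<and> A $$ (i, f i) \<and> B $$ (f i, i)"
    by metis
  \<comment> \<open>\<open>permutes\<close> asks for a map that fixes everything outside the set,
    hence the extension by the identity.\<close>
  define p where "p i = (if i < n then f i else i)" for i
  have "inj_on f {0..<n}"
    using f prod by (intro inj_onI) (metis atLeastLessThan_iff)
  then have "inj_on p {0..<n}"
    by (rule inj_on_cong[THEN iffD1, rotated]) (simp add: p_def)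
  moreover have "p ` {0..<n} \<subseteq> {0..<n}"
    using f by (auto simp: p_def)
  ultimately have "bij_betw p {0..<n} {0..<n}"
    using endo_inj_surj[of "{0..<n}" p] by (simp add: bij_betw_def)
  then have p: "p permutes {0..<n}"
    by (rule bij_imp_permutes) (simp add: p_def)
  have inv_less: "inv p i < n" if "i < n" for i
    using that permutes_in_image[OF permutes_inv[OF p], of i] by simp
  have pinv: "p (inv p i) = i" "inv p (p i) = i" for i
    by (simp_all add: permutes_inverses[OF p])
  \<comment> \<open>The index \<open>i\<close> is \<open>f\<close> of \<open>inv p i\<close>, so
    \<open>A\<close> has a one at \<open>(inv p i, i)\<close>. A one of \<open>B\<close> at
    \<open>(i, j)\<close> therefore puts a one of \<open>A * B\<close> at
    \<open>(inv p i, j)\<close>. The argument for \<open>A\<close> is symmetric.\<close>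
  have B_p: "B $$ (i, j) \<longleftrightarrow> j = inv p i" if "i < n" "j < n" for i j
    using f[of "inv p i"] inv_less[OF that(1)] pinv[of i] prod[of "inv p i" j] that
    by (auto simp: p_def)
  have A_p: "A $$ (i, j) \<longleftrightarrow> j = p i" if "i < n" "j < n" for i j
    using f[of i] f[of "inv p j"] inv_less[OF that(2)] pinv[of j] prod[of i "inv p j"] that
    by (auto simp: p_def)
  show "permutation_mat n B"
    unfolding permutation_mat_def using B B_p permutes_inv[OF p]
    by (intro exI[of _ "inv p"] conjI eq_matI) auto
  show "B * A = 1\<^sub>m n"
  proof (rule eq_matI)
    fix i j assume "i < dim_row (1\<^sub>m n :: bool mat)" "j < dim_col (1\<^sub>m n :: bool mat)"
    then have ij: "i < n" "j < n" by auto
    then have "(B * A) $$ (i, j) \<longleftrightarrow> i = j"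
      by (auto simp: index_mult_mat_bool[OF B A ij] A_p B_p pinv inv_less cong: conj_cong)
    then show "(B * A) $$ (i, j) = 1\<^sub>m n $$ (i, j)"
      using ij by simp
  qed (use A B in auto)
qed

lemma permutation_mat_mult_left:
  assumes p: "p permutes {0..<n}" and A: "A \<in> carrier_mat n m"
  shows "mat n n (\<lambda>(i, j). if j = p i then 1 else 0) * A = mat n m (\<lambda>(i, j). A $$ (p i, j) :: bool)"
proof -
  have p_less: "p i < n" if "i < n" for i
    using that permutes_in_image[OF p, of i] by simp
  show ?thesis
  proof (rule eq_matI)
    fix i j assume "i < dim_row (mat n m (\<lambda>(i, j). A $$ (p i, j)))"
      "j < dim_col (mat n m (\<lambda>(i, j). A $$ (p i, j)))"
    then have ij: "i < n" "j < m"
      by auto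
    show "(mat n n (\<lambda>(i, j). if j = p i then 1 else 0) * A) $$ (i, j)
        = mat n m (\<lambda>(i, j). A $$ (p i, j)) $$ (i, j)"
      using ij p_less by (simp add: index_mult_mat_bool[OF mat_carrier A] cong: conj_cong)
  qed (use A in auto)
qed

text \<open>The one in row \<open>i\<close> of this matrix is in column \<open>p i\<close>, so the
  one in column \<open>j\<close> is in row \<open>inv p j\<close>. This is why the inverse shows up
  here and not in multiplication from the left.\<close>

lemma permutation_mat_mult_right:
  assumes p: "p permutes {0..<n}" and A: "A \<in> carrier_mat m n"
  shows "A * mat n n (\<lambda>(i, j). if j = p i then 1 else 0)
    = mat m n (\<lambda>(i, j). A $$ (i, inv p j) :: bool)"
proof -
  have inv_less: "inv p i < n" if "i < n" for i
    using that permutes_in_image[OF permutes_inv[OF p], of i] by simp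
  show ?thesis
  proof (rule eq_matI)
    fix i j assume "i < dim_row (mat m n (\<lambda>(i, j). A $$ (i, inv p j)))"
      "j < dim_col (mat m n (\<lambda>(i, j). A $$ (i, inv p j)))"
    then have ij: "i < m" "j < n"
      by auto
    have "j = p k \<longleftrightarrow> k = inv p j" for k
      using permutes_inverses[OF p] by metis
    then show "(A * mat n n (\<lambda>(i, j). if j = p i then 1 else 0)) $$ (i, j)
        = mat m n (\<lambda>(i, j). A $$ (i, inv p j)) $$ (i, j)"
      using ij inv_less by (simp add: index_mult_mat_bool[OF A mat_carrier] cong: conj_cong)
  qed (use A in auto)
qed

text \<open>Serves to move the selected rows or columns to the front. The remaining positions are
  matched with the remaining values by an arbitrary bijection, as both sets have the same
  size.\<close>

lemma inj_on_extends_to_permutation: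
  fixes r :: "nat \<Rightarrow> nat"
  assumes inj: "inj_on r {..<n}" and r: "\<And>i. i < n \<Longrightarrow> r i < m"
  obtains p where "p permutes {0..<m}" "\<And>i. i < n \<Longrightarrow> p i = r i"
proof -
  have sub: "r ` {..<n} \<subseteq> {0..<m}"
    using r by auto
  have "n \<le> m"
    using card_inj_on_le[OF inj sub] by simp
  have "card {n..<m} = card ({0..<m} - r ` {..<n})"
    using sub by (simp add: card_Diff_subset card_image[OF inj])
  then obtain f where f: "bij_betw f {n..<m} ({0..<m} - r ` {..<n})"
    using finite_same_card_bij[of "{n..<m}" "{0..<m} - r ` {..<n}"] by auto
  define p where "p i = (if i < n then r i else if i < m then f i else i)" for i
  have "bij_betw p {..<n} (r ` {..<n})"
    using inj by (subst bij_betw_cong[of _ p r]) (auto simp: p_def bij_betw_def)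
  moreover have "bij_betw p {n..<m} ({0..<m} - r ` {..<n})"
    using f by (subst bij_betw_cong[of _ p f]) (auto simp: p_def)
  ultimately have "bij_betw p ({..<n} \<union> {n..<m}) (r ` {..<n} \<union> ({0..<m} - r ` {..<n}))"
    by (rule bij_betw_combine) auto
  moreover have "{..<n} \<union> {n..<m} = {0..<m}"
    using \<open>n \<le> m\<close> by auto
  moreover have "r ` {..<n} \<union> ({0..<m} - r ` {..<n}) = {0..<m}"
    using sub by auto
  ultimately have "p permutes {0..<m}"
    using \<open>n \<le> m\<close> by (intro bij_imp_permutes) (auto simp: p_def)
  then show thesis
    by (rule that) (simp add: p_def)
qed

section \<open>Free families, and the free rank as the size of a largest identity submatrix\<close>

lemma finsum_vec_bool_index:
  assumes "finite I" "v \<in> I \<rightarrow> carrier_vec n" "i < n"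
  shows "finsum_vec TYPE(bool) n v I $ i \<longleftrightarrow> (\<exists>x\<in>I. v x $ i)"
  using assms by (simp add: index_finsum_vec sum_bool_iff)

text \<open>If the family is free, the joins over \<open>J\<close> and \<open>J - {x}\<close> differ
  at some coordinate, and there only \<open>x\<close> can contribute. Conversely, at a coordinate
  private to \<open>x\<close> the join over a subset is true exactly when \<open>x\<close> belongs
  to the subset, so the join determines the subset.\<close>

lemma free_family_iff_private_coordinate:
  "free_family n J v \<longleftrightarrow> finite J \<and> v \<in> J \<rightarrow> carrier_vec n \<and>
     (\<forall>x\<in>J. \<exists>i<n. \<forall>y\<in>J. v y $ i \<longleftrightarrow> y = x)"
proof (cases "finite J \<and> v \<in> J \<rightarrow> carrier_vec n")
  case True
  note index = finsum_vec_bool_index[of _ v n]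
  have car: "v \<in> I \<rightarrow> carrier_vec n" and fin: "finite I" if "I \<subseteq> J" for I
    using True that by (auto intro: finite_subset)
  have "\<exists>i<n. \<forall>y\<in>J. v y $ i \<longleftrightarrow> y = x"
    if free: "free_family n J v" and x: "x \<in> J" for x
  proof -
    have "finsum_vec TYPE(bool) n v J \<noteq> finsum_vec TYPE(bool) n v (J - {x})"
      using free[unfolded free_family_def, THEN conjunct2, THEN conjunct2, rule_format, of J "J - {x}"] x
      by auto
    moreover have "finsum_vec TYPE(bool) n v J \<in> carrier_vec n"
      "finsum_vec TYPE(bool) n v (J - {x}) \<in> carrier_vec n"
      using car by (auto intro!: finsum_vec_closed)
    ultimately obtain i where i: "i < n"
      and "finsum_vec TYPE(bool) n v J $ i \<noteq> finsum_vec TYPE(bool) n v (J - {x}) $ i"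
      by (auto simp: vec_eq_iff)
    then have "(\<exists>y\<in>J. v y $ i) \<noteq> (\<exists>y\<in>J - {x}. v y $ i)"
      using index[OF fin car i, of J] index[OF fin car i, of "J - {x}"] by simp
    then have "\<forall>y\<in>J. v y $ i \<longleftrightarrow> y = x"
      by blast
    with i show ?thesis
      by blast
  qed
  moreover have "free_family n J v" if own: "\<forall>x\<in>J. \<exists>i<n. \<forall>y\<in>J. v y $ i \<longleftrightarrow> y = x"
  proof -
    have mem: "x \<in> I\<^sub>2" if "I\<^sub>1 \<subseteq> J" "I\<^sub>2 \<subseteq> J" "x \<in> I\<^sub>1"
      "finsum_vec TYPE(bool) n v I\<^sub>1 = finsum_vec TYPE(bool) n v I\<^sub>2" for I\<^sub>1 I\<^sub>2 x
    proof -
      obtain i where i: "i < n" "\<And>y. y \<in> J \<Longrightarrow> v y $ i \<longleftrightarrow> y = x"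
        using own \<open>I\<^sub>1 \<subseteq> J\<close> \<open>x \<in> I\<^sub>1\<close> by blast
      have "\<exists>y\<in>I\<^sub>1. v y $ i"
        using i(2)[of x] that by blast
      then have "\<exists>y\<in>I\<^sub>2. v y $ i"
        using index[OF fin car i(1), of I\<^sub>1] index[OF fin car i(1), of I\<^sub>2] that by simp
      then show ?thesis
        using i(2) \<open>I\<^sub>2 \<subseteq> J\<close> by blast
    qed
    have "I\<^sub>1 = I\<^sub>2" if "I\<^sub>1 \<subseteq> J" "I\<^sub>2 \<subseteq> J"
      "finsum_vec TYPE(bool) n v I\<^sub>1 = finsum_vec TYPE(bool) n v I\<^sub>2" for I\<^sub>1 I\<^sub>2
      using mem[of I\<^sub>1 I\<^sub>2] mem[of I\<^sub>2 I\<^sub>1] that by auto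
    then show ?thesis
      using True unfolding free_family_def by blast
  qed
  ultimately show ?thesis
    using True by blast
qed (auto simp: free_family_def)

lemma col_in_boolean_cone:
  assumes "k < dim_col X"
  shows "col X k \<in> boolean_cone X"
proof -
  have "col X k = X *\<^sub>v unit_vec (dim_col X) k"
    using assms by (intro eq_vecI)
      (auto simp: index_mult_mat_vec_bool[of X "dim_row X" "dim_col X"])
  then show ?thesis
    unfolding boolean_cone_def by auto
qed

text \<open>The row \<open>r i\<close> is a private coordinate of the member \<open>e i\<close>. As
  \<open>e j\<close> is the join of the columns selected by \<open>h j\<close>, one of these,
  \<open>c j\<close>, has a one in row \<open>r j\<close>. A one of that column in a different row
  \<open>r i\<close> would make \<open>e j\<close> true at the private coordinate of
  \<open>e i\<close>.\<close>

lemma free_subset_imp_identity_at: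
  assumes S: "S \<subseteq> boolean_cone X" and free: "free_family (dim_row X) S (\<lambda>v. v)"
  shows "\<exists>r c. identity_at X (card S) r c"
proof -
  let ?m = "dim_col X"
  have "finite S"
    using free by (simp add: free_family_def)
  then obtain e where e: "bij_betw e {..<card S} S"
    using ex_bij_betw_nat_finite[of S] by (auto simp: lessThan_atLeast0)
  have eS: "e i \<in> S" if "i < card S" for i
    using e that by (auto simp: bij_betw_def)
  have e_eq: "e j = e i \<longleftrightarrow> i = j" if "i < card S" "j < card S" for i j
    using e that by (auto simp: bij_betw_def inj_on_def)
  have "\<exists>h. \<forall>i<card S. h i \<in> carrier_vec ?m \<and> e i = X *\<^sub>v h i"
    using eS S unfolding boolean_cone_def by (intro choice_iff'[THEN iffD1]) auto
  then obtain h where h: "\<And>i. i < card S \<Longrightarrow> h i \<in> carrier_vec ?m"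
    and eh: "\<And>i. i < card S \<Longrightarrow> e i = X *\<^sub>v h i"
    by blast
  have "\<exists>r. \<forall>i<card S. r i < dim_row X \<and> (\<forall>y\<in>S. y $ r i \<longleftrightarrow> y = e i)"
    using free eS unfolding free_family_iff_private_coordinate
    by (intro choice_iff'[THEN iffD1]) blast
  then obtain r where r: "\<And>i. i < card S \<Longrightarrow> r i < dim_row X"
    and er: "\<And>i y. i < card S \<Longrightarrow> y \<in> S \<Longrightarrow> y $ r i \<longleftrightarrow> y = e i"
    by blast
  have Xh: "(\<exists>k<?m. X $$ (r i, k) \<and> h j $ k) \<longleftrightarrow> i = j"
    if "i < card S" "j < card S" for i j
  proof -
    have "(\<exists>k<?m. X $$ (r i, k) \<and> h j $ k) \<longleftrightarrow> e j $ r i"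
      unfolding eh[OF that(2)]
      by (rule index_mult_mat_vec_bool[symmetric]) (use that r h in auto)
    also have "\<dots> \<longleftrightarrow> i = j"
      using er e_eq eS that by simp
    finally show ?thesis .
  qed
  then have "\<forall>j<card S. \<exists>k<?m. X $$ (r j, k) \<and> h j $ k"
    by blast
  then obtain c where c: "\<And>j. j < card S \<Longrightarrow> c j < ?m \<and> X $$ (r j, c j) \<and> h j $ c j"
    by metis
  have "identity_at X (card S) r c"
    unfolding identity_at_def using r c Xh by blast
  then show ?thesis
    by blast
qed

text \<open>The selected columns of \<open>X\<close> themselves form the family: row
  \<open>r k\<close> is a private coordinate of column \<open>c k\<close>.\<close>

lemma identity_at_imp_free_subset:
  assumes id: "identity_at X n r c"
  shows "\<exists>S \<subseteq> boolean_cone X. free_family (dim_row X) S (\<lambda>v. v) \<and> card S = n"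
proof (intro exI conjI)
  let ?S = "(\<lambda>j. col X (c j)) ` {..<n}"
  have col: "col X (c j) $ r i \<longleftrightarrow> i = j" and r: "r i < dim_row X" and c: "c i < dim_col X"
    if "i < n" "j < n" for i j
    using id that by (auto simp: identity_at_def)
  have eq: "col X (c j) = col X (c i) \<longleftrightarrow> j = i" if "i < n" "j < n" for i j
    using col that by metis
  show "?S \<subseteq> boolean_cone X"
    using c by (auto intro: col_in_boolean_cone)
  show "card ?S = n"
    using eq by (subst card_image) (auto simp: inj_on_def)
  show "free_family (dim_row X) ?S (\<lambda>v. v)"
    unfolding free_family_iff_private_coordinate
  proof (intro conjI ballI)
    fix x assume "x \<in> ?S"
    then obtain k where k: "k < n" "x = col X (c k)"
      by blast
    then have "\<forall>y\<in>?S. y $ r k \<longleftrightarrow> y = x"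
      using col eq by auto
    then show "\<exists>i<dim_row X. \<forall>y\<in>?S. y $ i \<longleftrightarrow> y = x"
      using r k by blast
  qed auto
qed

text \<open>An inequality can be used here because an initial segment of an identity submatrix is
  again one. It turns the maximum into a plain existence statement.\<close>

lemma free_rank_ge_iff_identity_at: "n \<le> free_rank X \<longleftrightarrow> (\<exists>r c. identity_at X n r c)"
proof
  assume n: "n \<le> free_rank X"
  have "free_rank X \<in> {card S | S. S \<subseteq> boolean_cone X \<and> free_family (dim_row X) S (\<lambda>v. v)}"
    unfolding free_rank_def by (intro Max_in free_rank_set)
  then obtain r c where "identity_at X (free_rank X) r c"
    using free_subset_imp_identity_at by fastforce
  with n have "identity_at X n r c"
    by (auto simp: identity_at_def)
  then show "\<exists>r c. identity_at X n r c"
    by blast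
next
  assume "\<exists>r c. identity_at X n r c"
  then obtain S where "S \<subseteq> boolean_cone X" "free_family (dim_row X) S (\<lambda>v. v)" "card S = n"
    using identity_at_imp_free_subset by blast
  then show "n \<le> free_rank X"
    unfolding free_rank_def by (intro Max_ge free_rank_set) auto
qed

lemma free_rank_le_boolean_rank: "free_rank X \<le> boolean_rank X"
proof -
  obtain r c where "identity_at X (free_rank X) r c"
    using free_rank_ge_iff_identity_at by blast
  then show ?thesis
    using boolean_rank_attained[of X] identity_at_mult_le by metis
qed

section \<open>Factorizations whose inner dimension equals the size of an identity submatrix\<close>

text \<open>Since the inner dimension equals the size of the submatrix, the blocks \<open>U\<close>
  of \<open>H\<close> and \<open>V\<close> of \<open>W\<close> are square, and \<open>V * U\<close>
  is the submatrix itself. The right-hand sides for \<open>W * U\<close> and \<open>V * H\<close>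
  mention only the product, \<open>r\<close> and \<open>c\<close>, which is what makes the normal
  form independent of the factorization.\<close>

lemma factorization_through_identity_submatrix:
  fixes W H :: "bool mat"
  assumes id: "identity_at (W * H) R r c"
    and W: "W \<in> carrier_mat N R" and H: "H \<in> carrier_mat R M"
  obtains U V where "permutation_mat R U" "U \<in> carrier_mat R R" "V \<in> carrier_mat R R"
    "U * V = 1\<^sub>m R" "V * U = 1\<^sub>m R"
    "W * U = mat N R (\<lambda>(i, j). (W * H) $$ (i, c j))"
    "V * H = mat R M (\<lambda>(i, j). (W * H) $$ (r i, j))"
proof -
  define U where "U = mat R R (\<lambda>(i, j). H $$ (i, c j))"
  define V where "V = mat R R (\<lambda>(i, j). W $$ (r i, j))"
  have car: "U \<in> carrier_mat R R" "V \<in> carrier_mat R R"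
    by (simp_all add: U_def V_def)
  have r: "r i < N" and c: "c i < M" if "i < R" for i
    using id W H that by (auto simp: identity_at_def)
  have WU: "W * U = mat N R (\<lambda>(i, j). (W * H) $$ (i, c j))"
  proof (rule eq_matI)
    fix i j assume "i < dim_row (mat N R (\<lambda>(i, j). (W * H) $$ (i, c j)))"
      "j < dim_col (mat N R (\<lambda>(i, j). (W * H) $$ (i, c j)))"
    then show "(W * U) $$ (i, j) = mat N R (\<lambda>(i, j). (W * H) $$ (i, c j)) $$ (i, j)"
      using c by (auto simp: index_mult_mat_bool[OF W car(1)[unfolded U_def]] index_mult_mat_bool[OF W H] U_def)
  qed (use W car in auto)
  have VH: "V * H = mat R M (\<lambda>(i, j). (W * H) $$ (r i, j))"
  proof (rule eq_matI)
    fix i j assume "i < dim_row (mat R M (\<lambda>(i, j). (W * H) $$ (r i, j)))"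
      "j < dim_col (mat R M (\<lambda>(i, j). (W * H) $$ (r i, j)))"
    then show "(V * H) $$ (i, j) = mat R M (\<lambda>(i, j). (W * H) $$ (r i, j)) $$ (i, j)"
      using r by (auto simp: index_mult_mat_bool[OF car(2)[unfolded V_def] H] index_mult_mat_bool[OF W H] V_def)
  qed (use H car in auto)
  have VU: "V * U = 1\<^sub>m R"
  proof (rule eq_matI)
    fix i j assume "i < dim_row (1\<^sub>m R :: bool mat)" "j < dim_col (1\<^sub>m R :: bool mat)"
    then have ij: "i < R" "j < R" by auto
    then have "(V * U) $$ (i, j) \<longleftrightarrow> (W * H) $$ (r i, c j)"
      using r c by (simp add: index_mult_mat_bool[OF car(2,1)[unfolded U_def V_def]] index_mult_mat_bool[OF W H]
        U_def V_def cong: conj_cong)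
    then show "(V * U) $$ (i, j) = 1\<^sub>m R $$ (i, j)"
      using ij id by (simp add: identity_at_def)
  qed (use car in auto)
  show thesis
    using that[OF _ car _ VU WU VH] mult_one_imp_permutation[OF car(2,1) VU] by blast
qed

text \<open>All four fixed matrices are built from \<open>X\<close>, \<open>r\<close> and
  \<open>c\<close> before any factorization is considered. Each factorization is then carried to the
  selected columns and rows of \<open>X\<close>, which \<open>P\<close> and \<open>Q\<close> only
  reorder.\<close>

lemma identity_at_imp_canonical_form:
  assumes id: "identity_at X R r c" and X: "X \<in> carrier_mat N M"
  shows "\<exists>W' H' P Q.
    W' \<in> carrier_mat (N - R) R \<and> H' \<in> carrier_mat R (M - R) \<and>
    permutation_mat N P \<and> permutation_mat M Q \<and>
    (\<forall>W H. W \<in> carrier_mat N R \<longrightarrow> H \<in> carrier_mat R M \<longrightarrow> X = W * H \<longrightarrow>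
       (\<exists>U U_inv. permutation_mat R U \<and> U_inv \<in> carrier_mat R R \<and>
          inverts_mat U U_inv \<and> inverts_mat U_inv U \<and>
          P * W * U = 1\<^sub>m R @\<^sub>r W' \<and> U_inv * H * Q = 1\<^sub>m R @\<^sub>c H'))"
proof -
  have r: "r i < N" and c: "c i < M" if "i < R" for i
    using id X that by (auto simp: identity_at_def)
  have X_id: "X $$ (r i, c j) \<longleftrightarrow> i = j" if "i < R" "j < R" for i j
    using id that by (simp add: identity_at_def)
  obtain p where p: "p permutes {0..<N}" "\<And>i. i < R \<Longrightarrow> p i = r i"
    using inj_on_extends_to_permutation[OF identity_at_inj(1)[OF id] r] by metis
  obtain q where q: "q permutes {0..<M}" "\<And>i. i < R \<Longrightarrow> q i = c i"
    using inj_on_extends_to_permutation[OF identity_at_inj(2)[OF id] c] by metis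
  have le: "R \<le> N" "R \<le> M"
    using card_inj_on_le[OF identity_at_inj(1)[OF id], of "{..<N}"]
      card_inj_on_le[OF identity_at_inj(2)[OF id], of "{..<M}"] r c by auto
  have p_less: "p i < N" if "i < N" for i
    using that permutes_in_image[OF p(1), of i] by simp
  have q_less: "q i < M" if "i < M" for i
    using that permutes_in_image[OF q(1), of i] by simp
  have inv_q: "inv (inv q) = q"
    using permutes_inv_inv[OF q(1)] .
  define P :: "bool mat" where "P = mat N N (\<lambda>(i, j). if j = p i then 1 else 0)"
  \<comment> \<open>With \<open>inv q\<close> in the matrix, multiplication from the right brings
    column \<open>q j\<close> to position \<open>j\<close>.\<close>
  define Q :: "bool mat" where "Q = mat M M (\<lambda>(i, j). if j = inv q i then 1 else 0)"
  \<comment> \<open>\<open>p (R + i)\<close> runs through the rows outside the range of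
    \<open>r\<close>, and \<open>q (R + j)\<close> below through the columns outside the range of
    \<open>c\<close>.\<close>
  define W' where "W' = mat (N - R) R (\<lambda>(i, j). X $$ (p (R + i), c j))"
  define H' where "H' = mat R (M - R) (\<lambda>(i, j). X $$ (r i, q (R + j)))"
  have "permutation_mat N P" "permutation_mat M Q"
    unfolding permutation_mat_def P_def Q_def using p(1) permutes_inv[OF q(1)] by blast+
  moreover have "W' \<in> carrier_mat (N - R) R" "H' \<in> carrier_mat R (M - R)"
    by (simp_all add: W'_def H'_def)
  moreover have "\<exists>U U_inv. permutation_mat R U \<and> U_inv \<in> carrier_mat R R \<and>
      inverts_mat U U_inv \<and> inverts_mat U_inv U \<and>
      P * W * U = 1\<^sub>m R @\<^sub>r W' \<and> U_inv * H * Q = 1\<^sub>m R @\<^sub>c H'"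
    if W: "W \<in> carrier_mat N R" and H: "H \<in> carrier_mat R M" and XWH: "X = W * H" for W H
  proof -
    obtain U V where U: "permutation_mat R U" and car: "U \<in> carrier_mat R R" "V \<in> carrier_mat R R"
      and inv: "U * V = 1\<^sub>m R" "V * U = 1\<^sub>m R"
      and WU: "W * U = mat N R (\<lambda>(i, j). X $$ (i, c j))"
      and VH: "V * H = mat R M (\<lambda>(i, j). X $$ (r i, j))"
      using factorization_through_identity_submatrix[OF _ W H] id unfolding XWH by metis
    have "P * W * U = P * (W * U)"
      using W car by (intro assoc_mult_mat) (auto simp: P_def)
    also have "\<dots> = mat N R (\<lambda>(i, j). X $$ (p i, c j))"
      unfolding WU P_def using p_less by (subst permutation_mat_mult_left[OF p(1)]) auto
    also have "\<dots> = 1\<^sub>m R @\<^sub>r W'"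
      using le p(2) X_id unfolding append_rows_def W'_def
      by (intro eq_matI) auto
    finally have PWU: "P * W * U = 1\<^sub>m R @\<^sub>r W'" .
    have "V * H * Q = mat R M (\<lambda>(i, j). X $$ (r i, q j))"
      unfolding VH Q_def using q_less
      by (subst permutation_mat_mult_right[OF permutes_inv[OF q(1)]]) (auto simp: inv_q)
    also have "\<dots> = 1\<^sub>m R @\<^sub>c H'"
      using le q(2) X_id unfolding append_cols_def H'_def
      by (intro eq_matI) auto
    finally have VHQ: "V * H * Q = 1\<^sub>m R @\<^sub>c H'" .
    show ?thesis
      using U car inv PWU VHQ by (auto simp: inverts_mat_def)
  qed
  ultimately show ?thesis
    by blast
qed

text \<open>The identity blocks make the rows \<open>p i\<close> of \<open>W * U\<close> and the
  columns \<open>inv q j\<close> of \<open>V * H\<close> unit vectors for \<open>i, j < R\<close>.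
  Because \<open>W * H = (W * U) * (V * H)\<close>, these rows and columns of the product meet in an
  identity.\<close>

lemma canonical_form_imp_identity_at:
  assumes W: "W \<in> carrier_mat N R" and H: "H \<in> carrier_mat R M"
    and W': "W' \<in> carrier_mat (N - R) R" and H': "H' \<in> carrier_mat R (M - R)"
    and P: "permutation_mat N P" and Q: "permutation_mat M Q"
    and U: "permutation_mat R U" and V: "V \<in> carrier_mat R R" and inv: "inverts_mat U V"
    and PWU: "P * W * U = 1\<^sub>m R @\<^sub>r W'" and VHQ: "V * H * Q = 1\<^sub>m R @\<^sub>c H'"
  shows "\<exists>r c. identity_at (W * H) R r c"
proof -
  obtain p where p: "p permutes {0..<N}" "P = mat N N (\<lambda>(i, j). if j = p i then 1 else 0)"
    using P unfolding permutation_mat_def by blast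
  obtain q where q: "q permutes {0..<M}" "Q = mat M M (\<lambda>(i, j). if j = q i then 1 else 0)"
    using Q unfolding permutation_mat_def by blast
  have car: "P \<in> carrier_mat N N" "Q \<in> carrier_mat M M" "U \<in> carrier_mat R R"
    using p q U by (auto simp: permutation_mat_def)
  have "dim_row (P * W * U) = N" "dim_col (V * H * Q) = M"
    using car by auto
  \<comment> \<open>Truncated subtraction in \<open>N - R\<close> does not by itself give
    \<open>R \<le> N\<close>. It comes from the identity block, which has to fit into a matrix with
    \<open>N\<close> rows; likewise for \<open>M\<close>.\<close>
  then have le: "R \<le> N" "R \<le> M"
    unfolding PWU VHQ append_rows_def append_cols_def by auto
  have WU: "W * U \<in> carrier_mat N R" and VH: "V * H \<in> carrier_mat R M"
    using W H V car by auto
  have PWU_eq: "mat N R (\<lambda>(i, j). (W * U) $$ (p i, j)) = 1\<^sub>m R @\<^sub>r W'"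
    using PWU assoc_mult_mat[OF car(1) W car(3)] permutation_mat_mult_left[OF p(1) WU] p(2) by simp
  have VHQ_eq: "mat R M (\<lambda>(i, j). (V * H) $$ (i, inv q j)) = 1\<^sub>m R @\<^sub>c H'"
    using VHQ permutation_mat_mult_right[OF q(1) VH] q(2) by simp
  have WU_p: "(W * U) $$ (p i, j) \<longleftrightarrow> i = j" if "i < R" "j < R" for i j
    using arg_cong[OF PWU_eq, of "\<lambda>A. A $$ (i, j)"] that le W'
    by (simp add: append_rows_def)
  have VH_q: "(V * H) $$ (i, inv q j) \<longleftrightarrow> i = j" if "i < R" "j < R" for i j
    using arg_cong[OF VHQ_eq, of "\<lambda>A. A $$ (i, j)"] that le H'
    by (simp add: append_cols_def)
  have "W * H = W * (U * V * H)"
    using inv car H by (simp add: inverts_mat_def)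
  also have "\<dots> = W * U * (V * H)"
    using assoc_mult_mat[OF W car(3) VH] assoc_mult_mat[OF car(3) V H] by simp
  finally have WH: "W * H = W * U * (V * H)" .
  have "identity_at (W * H) R p (inv q)"
    unfolding identity_at_def
  proof (intro conjI allI impI)
    fix i assume "i < R"
    then show "p i < dim_row (W * H)" "inv q i < dim_col (W * H)"
      using le W H permutes_in_image[OF p(1), of i] permutes_in_image[OF permutes_inv[OF q(1)], of i]
      by auto
  next
    fix i j assume ij: "i < R" "j < R"
    then have "p i < N" "inv q j < M"
      using le permutes_in_image[OF p(1), of i] permutes_in_image[OF permutes_inv[OF q(1)], of j]
      by auto
    then show "(W * H) $$ (p i, inv q j) \<longleftrightarrow> i = j"
      unfolding WH using ij
      by (auto simp: index_mult_mat_bool[OF WU VH] WU_p VH_q)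
  qed
  then show ?thesis
    by blast
qed

text \<open>Both factorizations reduce to the same columns and rows of the product, so going from
  the first to this common pair and back to the second gives the change of factors
  \<open>U\<^sub>1 * V\<^sub>2\<close>, with inverse \<open>U\<^sub>2 * V\<^sub>1\<close>.\<close>

lemma identity_at_imp_factorization_unique:
  fixes W\<^sub>1 H\<^sub>1 W\<^sub>2 H\<^sub>2 :: "bool mat"
  assumes id: "identity_at (W\<^sub>1 * H\<^sub>1) R r c"
    and W1: "W\<^sub>1 \<in> carrier_mat N R" and H1: "H\<^sub>1 \<in> carrier_mat R M"
    and W2: "W\<^sub>2 \<in> carrier_mat N R" and H2: "H\<^sub>2 \<in> carrier_mat R M"
    and eq: "W\<^sub>1 * H\<^sub>1 = W\<^sub>2 * H\<^sub>2"
  shows "\<exists>U U_inv. U \<in> carrier_mat R R \<and> U_inv \<in> carrier_mat R R \<and>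
    inverts_mat U U_inv \<and> inverts_mat U_inv U \<and> W\<^sub>2 = W\<^sub>1 * U \<and> H\<^sub>2 = U_inv * H\<^sub>1"
proof -
  obtain U\<^sub>1 V\<^sub>1 where 1: "U\<^sub>1 \<in> carrier_mat R R" "V\<^sub>1 \<in> carrier_mat R R"
    "U\<^sub>1 * V\<^sub>1 = 1\<^sub>m R" "V\<^sub>1 * U\<^sub>1 = 1\<^sub>m R"
    "W\<^sub>1 * U\<^sub>1 = mat N R (\<lambda>(i, j). (W\<^sub>1 * H\<^sub>1) $$ (i, c j))"
    "V\<^sub>1 * H\<^sub>1 = mat R M (\<lambda>(i, j). (W\<^sub>1 * H\<^sub>1) $$ (r i, j))"
    using factorization_through_identity_submatrix[OF id W1 H1] by metis
  obtain U\<^sub>2 V\<^sub>2 where 2: "U\<^sub>2 \<in> carrier_mat R R" "V\<^sub>2 \<in> carrier_mat R R"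
    "U\<^sub>2 * V\<^sub>2 = 1\<^sub>m R" "V\<^sub>2 * U\<^sub>2 = 1\<^sub>m R"
    "W\<^sub>2 * U\<^sub>2 = mat N R (\<lambda>(i, j). (W\<^sub>1 * H\<^sub>1) $$ (i, c j))"
    "V\<^sub>2 * H\<^sub>2 = mat R M (\<lambda>(i, j). (W\<^sub>1 * H\<^sub>1) $$ (r i, j))"
    using factorization_through_identity_submatrix[OF id[unfolded eq] W2 H2] unfolding eq by metis
  have cancel: "A * B * (C * D) = 1\<^sub>m R" if "B * C = 1\<^sub>m R" "A * D = 1\<^sub>m R"
    "A \<in> carrier_mat R R" "B \<in> carrier_mat R R" "C \<in> carrier_mat R R" "D \<in> carrier_mat R R"
    for A B C D :: "bool mat"
  proof -
    have "A * B * (C * D) = A * (B * (C * D))"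
      using that by (intro assoc_mult_mat) auto
    also have "B * (C * D) = B * C * D"
      using assoc_mult_mat[of B R R C R D R] that by simp
    finally show ?thesis
      using that by simp
  qed
  have "W\<^sub>2 = W\<^sub>2 * (U\<^sub>2 * V\<^sub>2)"
    using W2 2 by simp
  also have "\<dots> = W\<^sub>1 * U\<^sub>1 * V\<^sub>2"
    using assoc_mult_mat[OF W2 2(1,2)] 1(5) 2(5) by simp
  also have "\<dots> = W\<^sub>1 * (U\<^sub>1 * V\<^sub>2)"
    by (rule assoc_mult_mat[OF W1 1(1) 2(2)])
  finally have W: "W\<^sub>2 = W\<^sub>1 * (U\<^sub>1 * V\<^sub>2)" .
  have "H\<^sub>2 = U\<^sub>2 * V\<^sub>2 * H\<^sub>2"
    using H2 2 by simp
  also have "\<dots> = U\<^sub>2 * (V\<^sub>1 * H\<^sub>1)"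
    using assoc_mult_mat[OF 2(1,2) H2] 1(6) 2(6) by simp
  also have "\<dots> = U\<^sub>2 * V\<^sub>1 * H\<^sub>1"
    by (rule assoc_mult_mat[OF 2(1) 1(2) H1, symmetric])
  finally have H: "H\<^sub>2 = U\<^sub>2 * V\<^sub>1 * H\<^sub>1" .
  have "U\<^sub>1 * V\<^sub>2 * (U\<^sub>2 * V\<^sub>1) = 1\<^sub>m R" "U\<^sub>2 * V\<^sub>1 * (U\<^sub>1 * V\<^sub>2) = 1\<^sub>m R"
    using 1 2 by (auto intro!: cancel)
  then show ?thesis
    using W H 1 2 by (intro exI[of _ "U\<^sub>1 * V\<^sub>2"] exI[of _ "U\<^sub>2 * V\<^sub>1"]) (auto simp: inverts_mat_def)
qed

theorem theorem5:
  fixes X :: "bool mat" and N M R :: nat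
  assumes "X \<in> carrier_mat N M"
    and "R = boolean_rank X"
  shows
    "(free_rank X = R \<longleftrightarrow>
       (\<exists>W' H' P Q.
          W' \<in> carrier_mat (N - R) R \<and> H' \<in> carrier_mat R (M - R) \<and>
          permutation_mat N P \<and> permutation_mat M Q \<and>
          (\<forall>W H. W \<in> carrier_mat N R \<longrightarrow> H \<in> carrier_mat R M \<longrightarrow> X = W * H \<longrightarrow>
             (\<exists>U U_inv. permutation_mat R U \<and> U_inv \<in> carrier_mat R R \<and>
                inverts_mat U U_inv \<and> inverts_mat U_inv U \<and>
                P * W * U = 1\<^sub>m R @\<^sub>r W' \<and>
                U_inv * H * Q = 1\<^sub>m R @\<^sub>c H'))))
     \<and>
     (free_rank X = R \<longrightarrow>
       (\<forall>W\<^sub>1 H\<^sub>1 W\<^sub>2 H\<^sub>2.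
          W\<^sub>1 \<in> carrier_mat N R \<longrightarrow> H\<^sub>1 \<in> carrier_mat R M \<longrightarrow> X = W\<^sub>1 * H\<^sub>1 \<longrightarrow>
          W\<^sub>2 \<in> carrier_mat N R \<longrightarrow> H\<^sub>2 \<in> carrier_mat R M \<longrightarrow> X = W\<^sub>2 * H\<^sub>2 \<longrightarrow>
          (\<exists>U U_inv. U \<in> carrier_mat R R \<and> U_inv \<in> carrier_mat R R \<and>
             inverts_mat U U_inv \<and> inverts_mat U_inv U \<and>
             W\<^sub>2 = W\<^sub>1 * U \<and> H\<^sub>2 = U_inv * H\<^sub>1)))"
proof -
  \<comment> \<open>As the free rank never exceeds the Boolean rank, equality amounts to
    \<open>R \<le> free_rank X\<close>.\<close>
  have rank: "free_rank X = R \<longleftrightarrow> (\<exists>r c. identity_at X R r c)"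
    using free_rank_le_boolean_rank[of X] free_rank_ge_iff_identity_at[of R X] assms(2) by auto
  \<comment> \<open>The canonical-form condition is universal over factorizations, so the direction
    from it back to the free rank needs one actual factorization to apply it to.\<close>
  obtain W H where WH: "W \<in> carrier_mat N R" "H \<in> carrier_mat R M" "X = W * H"
    using boolean_rank_attained[of X] assms by auto
  show ?thesis
    unfolding rank
  proof (intro conjI iffI impI allI)
    assume "\<exists>r c. identity_at X R r c"
    then show "\<exists>W' H' P Q.
          W' \<in> carrier_mat (N - R) R \<and> H' \<in> carrier_mat R (M - R) \<and>
          permutation_mat N P \<and> permutation_mat M Q \<and>
          (\<forall>W H. W \<in> carrier_mat N R \<longrightarrow> H \<in> carrier_mat R M \<longrightarrow> X = W * H \<longrightarrow>
             (\<exists>U U_inv. permutation_mat R U \<and> U_inv \<in> carrier_mat R R \<and>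
                inverts_mat U U_inv \<and> inverts_mat U_inv U \<and>
                P * W * U = 1\<^sub>m R @\<^sub>r W' \<and>
                U_inv * H * Q = 1\<^sub>m R @\<^sub>c H'))"
      using identity_at_imp_canonical_form[OF _ assms(1)] by blast
  next
    assume "\<exists>W' H' P Q.
          W' \<in> carrier_mat (N - R) R \<and> H' \<in> carrier_mat R (M - R) \<and>
          permutation_mat N P \<and> permutation_mat M Q \<and>
          (\<forall>W H. W \<in> carrier_mat N R \<longrightarrow> H \<in> carrier_mat R M \<longrightarrow> X = W * H \<longrightarrow>
             (\<exists>U U_inv. permutation_mat R U \<and> U_inv \<in> carrier_mat R R \<and>
                inverts_mat U U_inv \<and> inverts_mat U_inv U \<and>
                P * W * U = 1\<^sub>m R @\<^sub>r W' \<and>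
                U_inv * H * Q = 1\<^sub>m R @\<^sub>c H'))"
    then show "\<exists>r c. identity_at X R r c"
      using canonical_form_imp_identity_at[OF WH(1,2)] WH by metis
  next
    fix W\<^sub>1 H\<^sub>1 W\<^sub>2 H\<^sub>2
    assume "\<exists>r c. identity_at X R r c"
      and "W\<^sub>1 \<in> carrier_mat N R" "H\<^sub>1 \<in> carrier_mat R M" "X = W\<^sub>1 * H\<^sub>1"
      and "W\<^sub>2 \<in> carrier_mat N R" "H\<^sub>2 \<in> carrier_mat R M" "X = W\<^sub>2 * H\<^sub>2"
    then show "\<exists>U U_inv. U \<in> carrier_mat R R \<and> U_inv \<in> carrier_mat R R \<and>
             inverts_mat U U_inv \<and> inverts_mat U_inv U \<and>
             W\<^sub>2 = W\<^sub>1 * U \<and> H\<^sub>2 = U_inv * H\<^sub>1"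
      using identity_at_imp_factorization_unique by metis
  qed
qed

end
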